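(* For every $\varepsilon>0$ there exists $n_0$ such that for every $n\ge n_0$ and every set $\{v_1,\dots,v_n\}$ of $n$ positive integers (the speeds) there exists a time $t\in(0,1)$ such that $$ \|tv_i\|\;\geq\;\frac{1}{2n-2+\varepsilon}\qquad\text{for each } i\in\{1,\dots,n\}. $$
   Context: For a real number $x$, $\|x\|$ denotes the distance from $x$ to the closest integer. *)

theory Defs
  imports Complex_Main
begin

definition dist_int :: "real \<Rightarrow> real" where
  "dist_int x = \<bar>x - of_int (round x)\<bar>"

lemma dist_int_le: "dist_int x \<le> \<bar>x - of_int m\<bar>"
  unfolding dist_int_def by (rule round_diff_minimal)

end

theory Submission
  imports Defs "HOL-Analysis.Analysis" "HOL-Real_Asymp.Real_Asymp"
begin

text \<open>
  Put \<open>\<delta> = 1 / (2 n - 2 + \<epsilon>)\<close> and let \<open>A\<^sub>v\<close> be the set of times in the unit interval at which runner \<open>v\<close>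
  is closer than \<open>\<delta>\<close> to the origin. Each \<open>A\<^sub>v\<close> has measure \<open>2 \<delta>\<close>, so the sum of the measures,
  \<open>2 \<delta> n\<close>, exceeds \<open>1\<close> only by \<open>(2 - \<epsilon>) \<delta>\<close>. The \<open>A\<^sub>v\<close> therefore fail to cover the interval as soon as
  their overlaps can be shown to save more than that. If all but \<open>o(n)\<close> runners \<open>v\<close> are attached to
  some partner \<open>p v\<close> in the remaining set \<open>I\<close>, then the measure of the union is at most
  \<open>2 \<delta> n\<close> minus the sum of the measures of \<open>A\<^sub>v \<inter> A\<^sub>p\<^sub>v\<close> (lemma \<open>cover_bound\<close>). Were each such overlap
  as large as for independent events, namely \<open>4 \<delta>\<^sup>2\<close>, the saving would be about \<open>4 \<delta>\<^sup>2 n\<close>, which is close to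
  \<open>2 \<delta>\<close>; a loss of a factor \<open>1 - \<eta>\<close> in each overlap is affordable when \<open>\<eta>\<close> is small compared with \<open>\<epsilon>\<close>.
  
  Not every pair of runners is that well correlated. For coprime speeds \<open>a\<close> and \<open>b\<close>, averaging over the
  shifts of time by multiples of \<open>1 / (a b)\<close> and the Chinese remainder theorem turn the overlap into
  \<open>1 / (a b)\<close> times the mean of \<open>N\<^sub>a N\<^sub>b\<close>, where \<open>N\<^sub>a x\<close> counts the points of the lattice \<open>x + \<int>\<close> in the
  open interval of radius \<open>\<delta> a\<close> around \<open>0\<close> (lemma \<open>corr_coprime\<close>). Here \<open>N\<^sub>a\<close> has mean \<open>2 \<delta> a\<close>. This
  yields the overlap \<open>(1 - \<eta>) 4 \<delta>\<^sup>2\<close> in two cases: if \<open>\<delta> b\<close> is large, because \<open>N\<^sub>b \<ge> 2 \<delta> b - 1\<close>; and if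
  \<open>a \<le> b \<le> (1 + \<eta>) a\<close>, because then \<open>N\<^sub>a N\<^sub>b \<ge> N\<^sub>a\<^sup>2\<close> and the mean of a square is at least the square of
  the mean. So a weakly correlated pair of speeds \<open>v < w\<close> satisfies \<open>1 + \<eta> < w / v < 1 / (2 \<eta> \<delta>)\<close>
  (lemma \<open>weakly_correlated_ratio\<close>). A set of speeds that are pairwise weakly correlated thus grows
  geometrically inside a range of ratio \<open>O(n)\<close>, and has only \<open>O(log n)\<close> elements. A maximal such set
  serves as \<open>I\<close>: by maximality every other runner has a partner in it.
\<close>

section \<open>Periodic functions and their means\<close>

text \<open>
  Boundedness and measurability are bundled with \<open>1\<close>-periodicity since the three together are stable
  under all operations used below and make every mean an honest integral.
\<close>

definition periodic_bm :: "(real \<Rightarrow> real) \<Rightarrow> bool" where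
  "periodic_bm F \<longleftrightarrow> F \<in> borel_measurable borel \<and> bounded (range F) \<and> (\<forall>x. F (x + 1) = F x)"

definition mean :: "(real \<Rightarrow> real) \<Rightarrow> real" where
  "mean F = integral {0..1} F"

lemma periodic_bmI:
  assumes "F \<in> borel_measurable borel" "\<And>x. \<bar>F x\<bar> \<le> B" "\<And>x. F (x + 1) = F x"
  shows "periodic_bm F"
  using assms unfolding periodic_bm_def bounded_iff by auto

lemma periodic_bm_integrable:
  assumes "periodic_bm F"
  shows "F integrable_on {a..b}"
proof -
  have m: "F \<in> borel_measurable borel" and "bounded (range F)"
    using assms by (auto simp: periodic_bm_def)
  then obtain B where B: "\<And>x. norm (F x) \<le> B"
    by (auto simp: bounded_iff)
  show ?thesis
  proof (rule measurable_bounded_by_integrable_imp_integrable)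
    show "F \<in> borel_measurable (lebesgue_on {a..b})"
      using m by (intro measurable_restrict_space1 measurable_completion) simp
    show "(\<lambda>_. B) integrable_on {a..b}"
      by (rule integrable_const_ivl)
    show "{a..b} \<in> sets lebesgue"
      by auto
  qed (use B in auto)
qed

lemma periodic_add_nat:
  assumes "\<And>x::real. F (x + 1) = F x"
  shows "F (x + real n) = F x"
proof (induction n)
  case (Suc n)
  then show ?case
    using assms[of "x + real n"] by (simp add: add_ac)
qed simp

lemma periodic_bm_add_nat: "periodic_bm F \<Longrightarrow> F (x + real n) = F x"
  by (rule periodic_add_nat) (simp add: periodic_bm_def)

text \<open>
  The factor \<open>m\<close> has to be a natural number for the dilated function to have period \<open>1\<close> again.
\<close>

lemma periodic_bm_dilate:
  assumes "periodic_bm F"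
  shows "periodic_bm (\<lambda>x. F (real m * x + c))"
proof -
  have [measurable]: "F \<in> borel_measurable borel" and "bounded (range F)"
    using assms by (auto simp: periodic_bm_def)
  then obtain B where B: "\<And>x. norm (F x) \<le> B"
    by (auto simp: bounded_iff)
  show ?thesis
  proof (rule periodic_bmI)
    show "F (real m * (x + 1) + c) = F (real m * x + c)" for x
      using periodic_bm_add_nat[OF assms, of "real m * x + c" m] by (simp add: algebra_simps)
  qed (use B in auto)
qed

lemma periodic_bm_mult:
  assumes "periodic_bm F" "periodic_bm G"
  shows "periodic_bm (\<lambda>x. F x * G x)"
proof -
  have [measurable]: "F \<in> borel_measurable borel" "G \<in> borel_measurable borel"
    and "bounded (range F)" "bounded (range G)"
    using assms by (auto simp: periodic_bm_def)
  then obtain B C where B: "\<And>x. \<bar>F x\<bar> \<le> B" and C: "\<And>x. \<bar>G x\<bar> \<le> C"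
    unfolding bounded_iff by auto
  show ?thesis
  proof (rule periodic_bmI)
    show "\<bar>F x * G x\<bar> \<le> B * C" for x
      unfolding abs_mult by (intro mult_mono B C) (use B[of x] in auto)
  qed (use assms in \<open>auto simp: periodic_bm_def\<close>)
qed

lemma periodic_bm_sum:
  assumes "finite S" "\<And>i. i \<in> S \<Longrightarrow> periodic_bm (F i)"
  shows "periodic_bm (\<lambda>x. \<Sum>i\<in>S. F i x)"
proof -
  have "\<forall>i\<in>S. \<exists>B. \<forall>x. \<bar>F i x\<bar> \<le> B"
    using assms(2) unfolding periodic_bm_def bounded_iff by auto
  then obtain B where B: "\<And>i x. i \<in> S \<Longrightarrow> \<bar>F i x\<bar> \<le> B i"
    by metis
  show ?thesis
  proof (rule periodic_bmI)
    show "\<bar>\<Sum>i\<in>S. F i x\<bar> \<le> (\<Sum>i\<in>S. B i)" for x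
      by (rule order_trans[OF sum_abs sum_mono[OF B]])
    show "(\<lambda>x. \<Sum>i\<in>S. F i x) \<in> borel_measurable borel"
      using assms by (intro borel_measurable_sum) (auto simp: periodic_bm_def)
  qed (use assms in \<open>auto simp: periodic_bm_def\<close>)
qed

lemma periodic_bm_const: "periodic_bm (\<lambda>_. c)"
  by (rule periodic_bmI[of _ "\<bar>c\<bar>"]) auto

lemma periodic_bm_diff:
  assumes F: "periodic_bm F" and G: "periodic_bm G"
  shows "periodic_bm (\<lambda>x. F x - G x)"
proof -
  have "bounded (range F)" "bounded (range G)"
    using F G by (auto simp: periodic_bm_def)
  then obtain B C where B: "\<And>x. \<bar>F x\<bar> \<le> B" and C: "\<And>x. \<bar>G x\<bar> \<le> C"
    unfolding bounded_iff by auto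
  show ?thesis
  proof (rule periodic_bmI)
    show "\<bar>F x - G x\<bar> \<le> B + C" for x
      using abs_triangle_ineq4[of "F x" "G x"] B[of x] C[of x] by linarith
  qed (use F G in \<open>auto simp: periodic_bm_def\<close>)
qed

lemma mean_const: "mean (\<lambda>_. c) = c"
  by (simp add: mean_def)

lemma mean_diff:
  assumes "periodic_bm F" "periodic_bm G"
  shows "mean (\<lambda>x. F x - G x) = mean F - mean G"
  unfolding mean_def using assms periodic_bm_integrable by (intro integral_diff) auto

lemma mean_sum:
  assumes "finite S" "\<And>i. i \<in> S \<Longrightarrow> periodic_bm (F i)"
  shows "mean (\<lambda>x. \<Sum>i\<in>S. F i x) = (\<Sum>i\<in>S. mean (F i))"
  unfolding mean_def using assms periodic_bm_integrable by (intro integral_sum) auto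

lemma mean_mono:
  assumes "periodic_bm F" "periodic_bm G" "\<And>x. F x \<le> G x"
  shows "mean F \<le> mean G"
  unfolding mean_def using assms periodic_bm_integrable by (intro integral_le) auto

lemma mean_cmult: "mean (\<lambda>x. c * F x) = c * mean F"
  unfolding mean_def by simp

lemma integral_period_shift:
  assumes "periodic_bm F"
  shows "integral {real k..real k + 1} F = mean F"
proof -
  have "integral {0..1} (\<lambda>x. F (x + real k)) = integral {real k..real k + 1} F"
    using integral_shift_real_ivl[of "real k" "real k" "real k + 1" F] by simp
  then show ?thesis
    using periodic_bm_add_nat[OF assms] by (simp add: mean_def)
qed

lemma mean_dilate:
  assumes F: "periodic_bm F" and m: "m > 0"
  shows "mean (\<lambda>x. F (real m * x)) = mean F"
proof -
  have *: "integral {0..real k} F = real k * mean F" for k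
  proof (induction k)
    case (Suc k)
    have "integral {0..real k} F + integral {real k..real k + 1} F = integral {0..real k + 1} F"
      by (rule Henstock_Kurzweil_Integration.integral_combine) (auto intro: periodic_bm_integrable F)
    then show ?case
      using Suc integral_period_shift[OF F, of k] by (simp add: algebra_simps)
  qed simp
  have "(F has_integral (real m * mean F)) {0..real m}"
    using * periodic_bm_integrable[OF F] by (metis integrable_integral)
  from has_integral_stretch_real[OF this, of "real m"]
  have "((\<lambda>x. F (real m * x)) has_integral mean F) ((\<lambda>x. x / real m) ` {0..real m})"
    using m by simp
  moreover have "(\<lambda>x. x / real m) ` {0..real m} = {0..1}"
    using m image_divide_atLeastAtMost[of "real m" 0 "real m"] by simp
  ultimately show ?thesis
    unfolding mean_def[of "\<lambda>x. F (real m * x)"] by (intro integral_unique) simp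
qed

lemma mean_shift:
  assumes F: "periodic_bm F" and c: "0 \<le> c" "c \<le> 1"
  shows "mean (\<lambda>x. F (x + c)) = mean F"
proof -
  have "mean (\<lambda>x. F (x + c)) = integral {c..1 + c} F"
    using integral_shift_real_ivl[of c c "1 + c" F] by (simp add: mean_def)
  also have "\<dots> = integral {c..1} F + integral {1..1 + c} F"
    using c by (intro Henstock_Kurzweil_Integration.integral_combine[symmetric])
      (auto intro: periodic_bm_integrable F)
  also have "integral {1..1 + c} F = integral {0..c} (\<lambda>x. F (x + 1))"
    using integral_shift_real_ivl[of 1 1 "1 + c" F] by simp
  also have "\<dots> = integral {0..c} F"
    using F by (simp add: periodic_bm_def)
  also have "integral {c..1} F + integral {0..c} F = mean F"
    using Henstock_Kurzweil_Integration.integral_combine[of 0 c 1 F] c periodic_bm_integrable[OF F]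
    by (simp add: mean_def)
  finally show ?thesis .
qed

section \<open>Runners close to the origin\<close>

definition near :: "real \<Rightarrow> real \<Rightarrow> real" where
  "near \<delta> x = (if dist_int x < \<delta> then 1 else 0)"

text \<open>
  The measure of the times at which both runners are close to the origin.
\<close>

definition corr :: "real \<Rightarrow> nat \<Rightarrow> nat \<Rightarrow> real" where
  "corr \<delta> v w = mean (\<lambda>t. near \<delta> (real v * t) * near \<delta> (real w * t))"

text \<open>
  Equivalently, the \<open>1\<close>-periodization of the indicator function of the interval \<open>(-\<beta>, \<beta>)\<close>.
\<close>

definition lattice_count :: "real \<Rightarrow> real \<Rightarrow> real" where
  "lattice_count \<beta> x = real (card {k::int. \<bar>x + of_int k\<bar> < \<beta>})"

lemma near_nonneg: "0 \<le> near \<delta> x" and near_le_1: "near \<delta> x \<le> 1"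
  by (auto simp: near_def)

lemma dist_int_less_iff: "dist_int x < \<delta> \<longleftrightarrow> (\<exists>m::int. \<bar>x - of_int m\<bar> < \<delta>)"
  using dist_int_le[of x] unfolding dist_int_def by (meson le_less_trans)

lemma dist_int_add_1: "dist_int (x + 1) = dist_int x"
proof -
  have "round (x + 1) = round x + 1"
    using floor_add_int[of "x + 1/2" 1] by (simp add: round_def add_ac)
  then show ?thesis
    by (simp add: dist_int_def)
qed

lemma periodic_bm_near: "periodic_bm (near \<delta>)"
proof (rule periodic_bmI)
  have [measurable]: "dist_int \<in> borel_measurable borel"
    unfolding dist_int_def[abs_def] round_def by measurable
  show "near \<delta> \<in> borel_measurable borel"
    unfolding near_def[abs_def] by measurable
  show "\<bar>near \<delta> x\<bar> \<le> 1" for x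
    by (simp add: near_def)
  show "near \<delta> (x + 1) = near \<delta> x" for x
    by (simp add: near_def dist_int_add_1)
qed

lemma periodic_bm_near_dilate: "periodic_bm (\<lambda>t. near \<delta> (real v * t))"
  using periodic_bm_dilate[OF periodic_bm_near, of \<delta> v 0] by simp

text \<open>
  The interval \<open>[-\<delta>, 1 - \<delta>]\<close> is a more convenient period than \<open>[0, 1]\<close>: on it the close times form the
  single interval \<open>(-\<delta>, \<delta>)\<close>.
\<close>

lemma mean_near:
  assumes "0 < \<delta>" "\<delta> \<le> 1/2"
  shows "mean (near \<delta>) = 2 * \<delta>"
proof -
  have h: "(near \<delta> has_integral 2 * \<delta>) {-\<delta>..1 - \<delta>}"
  proof -
    have 1: "(near \<delta> has_integral 2 * \<delta>) {-\<delta>..\<delta>}"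
    proof (rule has_integral_spike_finite[where S = "{-\<delta>,\<delta>}" and f = "\<lambda>_. 1"])
      show "near \<delta> x = 1" if "x \<in> {-\<delta>..\<delta>} - {-\<delta>,\<delta>}" for x
      proof -
        have "\<bar>x - of_int 0\<bar> < \<delta>" using that by auto
        then show ?thesis unfolding near_def dist_int_less_iff by metis
      qed
      show "((\<lambda>_. 1) has_integral 2 * \<delta>) {-\<delta>..\<delta>}"
        using has_integral_const_real[of "1::real" "-\<delta>" \<delta>] assms by simp
    qed auto
    have 2: "(near \<delta> has_integral 0) {\<delta>..1 - \<delta>}"
    proof (rule has_integral_is_0)
      fix x assume x: "x \<in> {\<delta>..1 - \<delta>}"
      have "\<not> \<bar>x - of_int m\<bar> < \<delta>" for m :: int
      proof (cases "m \<le> 0")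
        case True
        then have "real_of_int m \<le> 0" by simp
        then show ?thesis using x by auto
      next
        case False
        then have "real_of_int m \<ge> 1" by simp
        then show ?thesis using x by auto
      qed
      then show "near \<delta> x = 0" unfolding near_def dist_int_less_iff by auto
    qed
    show ?thesis
      using has_integral_combine[OF _ _ 1 2] assms by simp
  qed
  have "mean (near \<delta>) = mean (\<lambda>x. near \<delta> (x + (1 - \<delta>)))"
    using mean_shift[OF periodic_bm_near, of "1 - \<delta>" \<delta>] assms by simp
  also have "\<dots> = mean (\<lambda>x. near \<delta> (x - \<delta>))"
  proof -
    have "near \<delta> (x + (1 - \<delta>)) = near \<delta> (x - \<delta>)" for x
      using dist_int_add_1[of "x - \<delta>"] by (simp add: near_def algebra_simps)
    then show ?thesis by simp
  qed
  also have "\<dots> = 2 * \<delta>"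
    using has_integral_shift_real_ivl[OF h, of "-\<delta>"] by (simp add: mean_def integral_unique)
  finally show ?thesis .
qed

lemma mean_near_dilate:
  assumes "0 < \<delta>" "\<delta> \<le> 1/2" "v > 0"
  shows "mean (\<lambda>t. near \<delta> (real v * t)) = 2 * \<delta>"
  using mean_dilate[OF periodic_bm_near, of v \<delta>] mean_near assms by simp

section \<open>Correlation of two runners\<close>

lemma lattice_set_eq:
  fixes x \<beta> :: real
  shows "{k::int. \<bar>x + of_int k\<bar> < \<beta>} = {\<lfloor>-x - \<beta>\<rfloor> + 1..\<lceil>\<beta> - x\<rceil> - 1}"
proof -
  have *: "\<bar>x + of_int k\<bar> < \<beta> \<longleftrightarrow> \<lfloor>-x - \<beta>\<rfloor> < k \<and> k < \<lceil>\<beta> - x\<rceil>" for k :: int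
    unfolding floor_less_iff less_ceiling_iff by auto
  show ?thesis
    unfolding * by auto
qed

lemma finite_lattice_set: "finite {k::int. \<bar>x + real_of_int k\<bar> < \<beta>}"
  unfolding lattice_set_eq by simp

text \<open>
  An open interval of length \<open>2 \<beta>\<close> misses at most one point of the expected number.
\<close>

lemma lattice_count_ge: "2 * \<beta> - 1 \<le> lattice_count \<beta> x"
proof -
  have "real_of_int \<lfloor>-x - \<beta>\<rfloor> \<le> -x - \<beta>" "real_of_int \<lceil>\<beta> - x\<rceil> \<ge> \<beta> - x"
    by linarith+
  then have "2 * \<beta> - 1 \<le> of_int (\<lceil>\<beta> - x\<rceil> - 1 - \<lfloor>-x - \<beta>\<rfloor>)"
    unfolding of_int_diff of_int_1 by linarith
  also have "\<dots> \<le> real (nat (\<lceil>\<beta> - x\<rceil> - 1 - \<lfloor>-x - \<beta>\<rfloor>))"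
    by linarith
  finally show ?thesis
    unfolding lattice_count_def lattice_set_eq by simp
qed

lemma lattice_count_nonneg: "0 \<le> lattice_count \<beta> x"
  by (simp add: lattice_count_def)

lemma lattice_count_mono: "\<alpha> \<le> \<beta> \<Longrightarrow> lattice_count \<alpha> x \<le> lattice_count \<beta> x"
  unfolding lattice_count_def by (intro of_nat_mono card_mono finite_lattice_set) auto

lemma lattice_count_add_1: "lattice_count \<beta> (x + 1) = lattice_count \<beta> x"
proof -
  have "bij_betw (\<lambda>k. k + 1) {k::int. \<bar>x + 1 + of_int k\<bar> < \<beta>} {k::int. \<bar>x + of_int k\<bar> < \<beta>}"
    by (rule bij_betwI[where g = "\<lambda>k. k - 1"]) (auto simp: algebra_simps)
  then show ?thesis
    unfolding lattice_count_def by (simp add: bij_betw_same_card)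
qed

text \<open>
  The point \<open>(x + i) / a\<close> is within \<open>\<delta>\<close> of an integer \<open>m\<close> iff the lattice point \<open>x + (i - a m)\<close> is within
  \<open>\<delta> a\<close> of \<open>0\<close>. Reduction modulo \<open>a\<close> therefore maps the close lattice points onto the indices that
  contribute to the sum. It is injective because two close lattice points differ by less than
  \<open>2 \<delta> a \<le> a\<close>.
\<close>

lemma sum_near_eq_lattice_count:
  assumes a: "a > 0" and \<delta>: "\<delta> \<le> 1/2"
  shows "(\<Sum>i<a. near \<delta> ((x + real i) / real a)) = lattice_count (\<delta> * real a) x"
proof -
  let ?K = "{k::int. \<bar>x + of_int k\<bar> < \<delta> * real a}"
  let ?I = "{i. i < a \<and> dist_int ((x + real i) / real a) < \<delta>}"
  have near_iff: "dist_int ((x + real i) / real a) < \<delta>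
      \<longleftrightarrow> (\<exists>m::int. int i - int a * m \<in> ?K)" for i
  proof -
    have "\<bar>(x + real i) / real a - of_int m\<bar> < \<delta> \<longleftrightarrow> int i - int a * m \<in> ?K" for m :: int
    proof -
      have "(x + real i) / real a - of_int m = (x + of_int (int i - int a * m)) / real a"
        using a by (simp add: field_simps)
      then show ?thesis
        using a by (simp add: abs_divide pos_divide_less_eq)
    qed
    then show ?thesis unfolding dist_int_less_iff by blast
  qed
  have "bij_betw (\<lambda>k. nat (k mod int a)) ?K ?I"
  proof (rule bij_betw_imageI)
    show "inj_on (\<lambda>k. nat (k mod int a)) ?K"
    proof (rule inj_onI)
      fix k l assume k: "k \<in> ?K" and l: "l \<in> ?K" and "nat (k mod int a) = nat (l mod int a)"
      then have "k mod int a = l mod int a"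
        using a by (metis Euclidean_Rings.pos_mod_sign int_nat_eq of_nat_0_less_iff)
      then have "int a dvd k - l"
        by (simp add: mod_eq_dvd_iff)
      moreover have "\<bar>k - l\<bar> < int a"
      proof -
        have "\<bar>real_of_int (k - l)\<bar> < 2 * (\<delta> * real a)" using k l by auto
        also have "\<dots> \<le> real a" using \<delta> mult_right_mono[of "2 * \<delta>" 1 "real a"] by simp
        finally show ?thesis by linarith
      qed
      ultimately show "k = l"
        using zdvd_imp_le[of "int a" "\<bar>k - l\<bar>"] by auto
    qed
    show "(\<lambda>k. nat (k mod int a)) ` ?K = ?I"
    proof (intro equalityI subsetI)
      fix i assume "i \<in> (\<lambda>k. nat (k mod int a)) ` ?K"
      then obtain k where k: "k \<in> ?K" "i = nat (k mod int a)" by auto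
      have i: "int i = k mod int a" using a k by simp
      have "k mod int a < int a" using a by simp
      moreover have "int i - int a * (-(k div int a)) = k"
        using i by (simp add: mult.commute)
      ultimately show "i \<in> ?I"
        using k i near_iff[of i] by (metis (no_types, lifting) mem_Collect_eq of_nat_less_iff)
    next
      fix i assume "i \<in> ?I"
      then obtain m where i: "i < a" and m: "int i - int a * m \<in> ?K"
        using near_iff[of i] by auto
      have "(int i - int a * m) mod int a = int i mod int a"
        by (simp add: mod_eq_dvd_iff)
      then have "(int i - int a * m) mod int a = int i"
        using i by simp
      then show "i \<in> (\<lambda>k. nat (k mod int a)) ` ?K"
        using m by (metis (no_types, lifting) imageI nat_int)
    qed
  qed
  then have "card ?K = card ?I" by (rule bij_betw_same_card)
  moreover have "(\<Sum>i<a. near \<delta> ((x + real i) / real a)) = real (card ?I)"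
  proof -
    have "{..<a} \<inter> {i. dist_int ((x + real i) / real a) < \<delta>} = ?I" by auto
    then show ?thesis unfolding near_def by (simp add: sum.If_cases)
  qed
  ultimately show ?thesis by (simp add: lattice_count_def)
qed

lemma periodic_bm_lattice_count:
  assumes a: "a > 0" and \<delta>: "\<delta> \<le> 1/2"
  shows "periodic_bm (lattice_count (\<delta> * real a))"
proof (rule periodic_bmI)
  have eq: "lattice_count (\<delta> * real a) = (\<lambda>x. \<Sum>i<a. near \<delta> ((x + real i) / real a))"
    using sum_near_eq_lattice_count[OF assms] by auto
  have [measurable]: "near \<delta> \<in> borel_measurable borel"
    using periodic_bm_near by (simp add: periodic_bm_def)
  show "lattice_count (\<delta> * real a) \<in> borel_measurable borel"
    unfolding eq by measurable
  show "\<bar>lattice_count (\<delta> * real a) x\<bar> \<le> (\<Sum>i<a. 1)" for x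
    unfolding eq
    by (rule order_trans[OF sum_abs sum_mono]) (simp add: near_def)
qed (rule lattice_count_add_1)

lemma sum_near_shifts_eq_lattice_count:
  assumes "a > 0" "\<delta> \<le> 1/2"
  shows "(\<Sum>i<a. near \<delta> (t + real i / real a)) = lattice_count (\<delta> * real a) (real a * t)"
proof -
  have "t + real i / real a = (real a * t + real i) / real a" for i
    using assms by (simp add: field_simps)
  then show ?thesis
    using sum_near_eq_lattice_count[OF assms, of "real a * t"] by simp
qed

text \<open>
  The dilation \<open>x = a t\<close> leaves the mean unchanged and turns the count into a sum of \<open>a\<close> translates of
  the function \<open>near \<delta>\<close>, each of mean \<open>2 \<delta>\<close>.
\<close>

lemma mean_lattice_count:
  assumes a: "a > 0" and \<delta>: "0 < \<delta>" "\<delta> \<le> 1/2"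
  shows "mean (lattice_count (\<delta> * real a)) = 2 * (\<delta> * real a)"
proof -
  have "mean (lattice_count (\<delta> * real a)) = mean (\<lambda>t. lattice_count (\<delta> * real a) (real a * t))"
    using mean_dilate[OF periodic_bm_lattice_count[OF a \<delta>(2)] a] by simp
  also have "\<dots> = mean (\<lambda>t. \<Sum>i<a. near \<delta> (t + real i / real a))"
    using sum_near_shifts_eq_lattice_count[OF a \<delta>(2)] by simp
  also have "\<dots> = (\<Sum>i<a. mean (\<lambda>t. near \<delta> (t + real i / real a)))"
    using periodic_bm_dilate[OF periodic_bm_near, of \<delta> 1] by (intro mean_sum) auto
  also have "\<dots> = (\<Sum>i<a. 2 * \<delta>)"
    using mean_shift[OF periodic_bm_near] mean_near[OF \<delta>] a by (intro sum.cong) auto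
  finally show ?thesis by simp
qed

lemma sum_residues_coprime:
  fixes f g :: "nat \<Rightarrow> real"
  assumes "coprime a b" "a > 0" "b > 0"
  shows "(\<Sum>k<a * b. f (k mod b) * g (k mod a)) = (\<Sum>i<b. f i) * (\<Sum>j<a. g j)"
proof -
  let ?r = "\<lambda>k. (k mod b, k mod a)"
  have inj: "inj_on ?r {..<a * b}"
  proof (rule linorder_inj_onI')
    fix k l assume kl: "k \<in> {..<a * b}" "l \<in> {..<a * b}" "k < l"
    show "?r k \<noteq> ?r l"
    proof
      assume "?r k = ?r l"
      then have "b dvd l - k" "a dvd l - k"
        using kl mod_eq_dvd_iff_nat[of k l b] mod_eq_dvd_iff_nat[of k l a] by simp_all
      then have "a * b dvd l - k"
        using assms(1) divides_mult by blast
      then show False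
        using kl by (metis (no_types) dvd_imp_le lessThan_iff less_imp_diff_less not_le zero_less_diff)
    qed
  qed
  have "?r ` {..<a * b} = {..<b} \<times> {..<a}"
  proof (rule card_subset_eq)
    show "card (?r ` {..<a * b}) = card ({..<b} \<times> {..<a})"
      using card_image[OF inj] by (simp add: mult.commute)
  qed (use assms in auto)
  then have "(\<Sum>k<a * b. f (k mod b) * g (k mod a)) = (\<Sum>(i, j)\<in>{..<b} \<times> {..<a}. f i * g j)"
    using sum.reindex[OF inj, of "\<lambda>(i, j). f i * g j"] by simp
  then show ?thesis
    by (simp add: sum_product sum.cartesian_product)
qed

lemma periodic_bm_mod:
  assumes "periodic_bm F" "b > 0"
  shows "F (x + real k / real b) = F (x + real (k mod b) / real b)"
proof -
  have "real k = real b * real (k div b) + real (k mod b)"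
    by (metis mult_div_mod_eq of_nat_add of_nat_mult)
  then have "real k / real b = real (k mod b) / real b + real (k div b)"
    using assms by (simp add: field_simps)
  then show ?thesis
    using periodic_bm_add_nat[OF assms(1), of "x + real (k mod b) / real b" "k div b"]
    by (simp add: add_ac)
qed

text \<open>
  The mean of \<open>F t = near \<delta> (a t) * near \<delta> (b t)\<close> does not change when \<open>t\<close> is shifted by \<open>k / (a b)\<close>,
  so it may be averaged over \<open>k < a b\<close>. The shift moves the two arguments by \<open>k / b\<close> and \<open>k / a\<close>, which
  matter only modulo \<open>1\<close>; as \<open>k\<close> varies, the pair of residues of \<open>k\<close> takes each value exactly once, and
  the sum over \<open>k\<close> factorizes into two lattice counts at the common point \<open>a b t\<close>.
\<close>

lemma corr_coprime:
  assumes ab: "coprime a b" "a > 0" "b > 0" and \<delta>: "\<delta> \<le> 1/2"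
  shows "real a * real b * corr \<delta> a b =
    mean (\<lambda>x. lattice_count (\<delta> * real a) x * lattice_count (\<delta> * real b) x)"
proof -
  define F where "F = (\<lambda>t. near \<delta> (real a * t) * near \<delta> (real b * t))"
  define G where "G = (\<lambda>x. lattice_count (\<delta> * real a) x * lattice_count (\<delta> * real b) x)"
  have F: "periodic_bm F"
    unfolding F_def by (intro periodic_bm_mult periodic_bm_near_dilate)
  have G: "periodic_bm G"
    unfolding G_def using ab \<delta> by (intro periodic_bm_mult periodic_bm_lattice_count)
  have "real a * real b * corr \<delta> a b = (\<Sum>k<a * b. mean F)"
    by (simp add: corr_def F_def)
  also have "\<dots> = (\<Sum>k<a * b. mean (\<lambda>t. F (t + real k / real (a * b))))"
  proof (intro sum.cong refl)
    fix k assume "k \<in> {..<a * b}"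
    then have "real k \<le> real (a * b)" by (simp del: of_nat_mult)
    then have "real k / real (a * b) \<le> 1"
      using ab by (simp del: of_nat_mult)
    then show "mean F = mean (\<lambda>t. F (t + real k / real (a * b)))"
      by (intro mean_shift[OF F, symmetric]) auto
  qed
  also have "\<dots> = mean (\<lambda>t. \<Sum>k<a * b. F (t + real k / real (a * b)))"
    using periodic_bm_dilate[OF F, of 1] by (intro mean_sum[symmetric]) auto
  also have "(\<lambda>t. \<Sum>k<a * b. F (t + real k / real (a * b))) = (\<lambda>t. G (real (a * b) * t))"
  proof
    fix t
    have "F (t + real k / real (a * b)) =
        near \<delta> (real a * t + real (k mod b) / real b) * near \<delta> (real b * t + real (k mod a) / real a)" for k
    proof -
      have "real a * (t + real k / real (a * b)) = real a * t + real k / real b"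
        "real b * (t + real k / real (a * b)) = real b * t + real k / real a"
        using ab by (auto simp: field_simps)
      then show ?thesis
        using periodic_bm_mod[OF periodic_bm_near ab(3), of \<delta> "real a * t" k]
          periodic_bm_mod[OF periodic_bm_near ab(2), of \<delta> "real b * t" k]
        unfolding F_def by simp
    qed
    then have "(\<Sum>k<a * b. F (t + real k / real (a * b))) =
       (\<Sum>k<a * b. near \<delta> (real a * t + real (k mod b) / real b) * near \<delta> (real b * t + real (k mod a) / real a))"
      by simp
    also have "\<dots> = lattice_count (\<delta> * real b) (real b * (real a * t)) *
        lattice_count (\<delta> * real a) (real a * (real b * t))"
      using sum_residues_coprime[OF ab, of "\<lambda>i. near \<delta> (real a * t + real i / real b)"
          "\<lambda>j. near \<delta> (real b * t + real j / real a)"]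
        sum_near_shifts_eq_lattice_count \<delta> ab by simp
    finally show "(\<Sum>k<a * b. F (t + real k / real (a * b))) = G (real (a * b) * t)"
      by (simp add: G_def mult_ac)
  qed
  also have "mean \<dots> = mean G"
    using ab by (intro mean_dilate G) auto
  finally show ?thesis by (simp add: G_def)
qed

lemma corr_scale:
  assumes "g > 0"
  shows "corr \<delta> (g * a) (g * b) = corr \<delta> a b"
proof -
  have "periodic_bm (\<lambda>t. near \<delta> (real a * t) * near \<delta> (real b * t))"
    by (intro periodic_bm_mult periodic_bm_near_dilate)
  from mean_dilate[OF this assms] show ?thesis
    by (simp add: corr_def mult_ac)
qed

lemma corr_commute: "corr \<delta> v w = corr \<delta> w v"
  by (simp add: corr_def mult.commute)

text \<open>
  The faster runner makes so many visits that the bound \<open>N\<^sub>b \<ge> 2 \<delta> b - 1\<close> is already within a factor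
  \<open>1 - \<eta>\<close> of the mean of \<open>N\<^sub>b\<close>.
\<close>

lemma corr_ge_of_large:
  assumes ab: "coprime a b" "a > 0" "b > 0" and \<delta>: "0 < \<delta>" "\<delta> \<le> 1/2"
    and large: "1 \<le> 2 * \<eta> * (\<delta> * real b)"
  shows "(1 - \<eta>) * (4 * \<delta>\<^sup>2) \<le> corr \<delta> a b"
proof -
  let ?A = "lattice_count (\<delta> * real a)" and ?B = "lattice_count (\<delta> * real b)"
  have "real a * real b * ((1 - \<eta>) * (4 * \<delta>\<^sup>2)) =
      (2 * (\<delta> * real b) - 2 * \<eta> * (\<delta> * real b)) * (2 * (\<delta> * real a))"
    by (simp add: power2_eq_square algebra_simps)
  also have "\<dots> \<le> (2 * (\<delta> * real b) - 1) * (2 * (\<delta> * real a))"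
    using large \<delta> by (intro mult_right_mono) auto
  also have "\<dots> = mean (\<lambda>x. (2 * (\<delta> * real b) - 1) * ?A x)"
    using mean_lattice_count[of a \<delta>] ab \<delta> by (simp add: mean_cmult)
  also have "\<dots> \<le> mean (\<lambda>x. ?A x * ?B x)"
  proof (rule mean_mono)
    show "periodic_bm (\<lambda>x. (2 * (\<delta> * real b) - 1) * ?A x)"
      using ab \<delta> by (intro periodic_bm_mult periodic_bm_const periodic_bm_lattice_count)
    show "periodic_bm (\<lambda>x. ?A x * ?B x)"
      using ab \<delta> by (intro periodic_bm_mult periodic_bm_lattice_count)
    show "(2 * (\<delta> * real b) - 1) * ?A x \<le> ?A x * ?B x" for x
      using mult_right_mono[OF lattice_count_ge[of "\<delta> * real b" x] lattice_count_nonneg[of "\<delta> * real a" x]]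
      by (simp add: mult.commute)
  qed
  also have "\<dots> = real a * real b * corr \<delta> a b"
    using corr_coprime ab \<delta> by simp
  finally show ?thesis
    using ab by simp
qed

text \<open>
  Since \<open>a \<le> b\<close>, the product of the two counts dominates the square of the smaller one, whose mean is at
  least \<open>(2 \<delta> a)\<^sup>2\<close>. Replacing one factor \<open>a\<close> by \<open>b\<close> costs at most the factor \<open>1 - \<eta>\<close>.
\<close>

lemma corr_ge_of_close:
  assumes ab: "coprime a b" "a > 0" "a \<le> b" and \<delta>: "0 < \<delta>" "\<delta> \<le> 1/2"
    and close: "real b \<le> (1 + \<eta>) * real a" and \<eta>: "0 \<le> \<eta>"
  shows "(1 - \<eta>) * (4 * \<delta>\<^sup>2) \<le> corr \<delta> a b"
proof -
  let ?A = "lattice_count (\<delta> * real a)" and ?B = "lattice_count (\<delta> * real b)"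
  define \<mu> where "\<mu> = 2 * (\<delta> * real a)"
  have b: "b > 0" using ab(2,3) by linarith
  have A: "periodic_bm ?A" and B: "periodic_bm ?B"
    by (rule periodic_bm_lattice_count[OF ab(2) \<delta>(2)], rule periodic_bm_lattice_count[OF b \<delta>(2)])
  have "(1 - \<eta>) * real b \<le> real a"
  proof (cases "\<eta> \<le> 1")
    case True
    have "(1 - \<eta>) * real b \<le> (1 - \<eta>) * ((1 + \<eta>) * real a)"
      using True close by (intro mult_left_mono) auto
    also have "\<dots> = (1 - \<eta>\<^sup>2) * real a" by (simp add: power2_eq_square algebra_simps)
    also have "\<dots> \<le> 1 * real a" by (intro mult_right_mono) auto
    finally show ?thesis by simp
  next
    case False
    then have "(1 - \<eta>) * real b \<le> 0" by (simp add: mult_nonpos_nonneg)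
    then show ?thesis by linarith
  qed
  then have "(4 * \<delta>\<^sup>2 * real a) * ((1 - \<eta>) * real b) \<le> (4 * \<delta>\<^sup>2 * real a) * real a"
    by (intro mult_left_mono) auto
  then have "real a * real b * ((1 - \<eta>) * (4 * \<delta>\<^sup>2)) \<le> \<mu>\<^sup>2"
    by (simp add: \<mu>_def power2_eq_square algebra_simps)
  also have "\<mu>\<^sup>2 = 2 * \<mu> * mean ?A - \<mu>\<^sup>2"
    using mean_lattice_count[OF ab(2) \<delta>] by (simp add: \<mu>_def power2_eq_square)
  also have "\<dots> = mean (\<lambda>x. 2 * \<mu> * ?A x - \<mu>\<^sup>2)"
    using mean_diff[OF periodic_bm_mult[OF periodic_bm_const A] periodic_bm_const]
    by (simp only: mean_cmult mean_const)
  also have "\<dots> \<le> mean (\<lambda>x. ?A x * ?B x)"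
  proof (rule mean_mono)
    show "periodic_bm (\<lambda>x. 2 * \<mu> * ?A x - \<mu>\<^sup>2)"
      by (intro periodic_bm_diff periodic_bm_mult periodic_bm_const A)
    show "periodic_bm (\<lambda>x. ?A x * ?B x)"
      by (intro periodic_bm_mult A B)
    fix x :: real
    \<comment> \<open>The tangent of the square at the mean \<open>\<mu>\<close> replaces an appeal to the Cauchy-Schwarz inequality.\<close>
    have "2 * \<mu> * ?A x - \<mu>\<^sup>2 \<le> ?A x * ?A x"
      using zero_le_power2[of "?A x - \<mu>"] by (simp add: power2_eq_square algebra_simps)
    also have "\<dots> \<le> ?A x * ?B x"
      using ab \<delta> by (intro mult_left_mono lattice_count_mono lattice_count_nonneg) auto
    finally show "2 * \<mu> * ?A x - \<mu>\<^sup>2 \<le> ?A x * ?B x" .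
  qed
  also have "\<dots> = real a * real b * corr \<delta> a b"
    using corr_coprime ab b \<delta> by simp
  finally show ?thesis
    using ab b by simp
qed

text \<open>
  Both bounds hold for the reduced speeds \<open>a = v / g\<close> and \<open>b = w / g\<close> by the two preceding lemmas. The
  second one, \<open>2 \<eta> \<delta> b < 1\<close>, passes to \<open>v\<close> and \<open>w\<close> because \<open>1 \<le> a\<close>.
\<close>

lemma weakly_correlated_ratio:
  assumes v: "0 < v" "v < w" and \<delta>: "0 < \<delta>" "\<delta> \<le> 1/2" and \<eta>: "0 < \<eta>"
    and weak: "corr \<delta> v w < (1 - \<eta>) * (4 * \<delta>\<^sup>2)"
  shows "(1 + \<eta>) * real v < real w" and "2 * \<eta> * \<delta> * real w < real v"
proof -
  define g where "g = gcd v w"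
  have g: "g > 0" using v by (simp add: g_def)
  then obtain a b where ab: "v = g * a" "w = g * b" "coprime a b"
    using gcd_coprime_exists[of v w] unfolding g_def by (metis mult.commute less_numeral_extra(3))
  have "g * a < g * b" "0 < g * a" using v ab(1,2) by simp_all
  then have pos: "g > 0" "a > 0" "b > 0" "a \<le> b"
    using g by auto
  have weak': "corr \<delta> a b < (1 - \<eta>) * (4 * \<delta>\<^sup>2)"
    using weak corr_scale[OF pos(1)] ab by simp
  have "\<not> real b \<le> (1 + \<eta>) * real a"
    using corr_ge_of_close[OF ab(3) pos(2,4) \<delta>, of \<eta>] weak' \<eta> by linarith
  then have "real g * ((1 + \<eta>) * real a) < real g * real b"
    using pos by (intro mult_strict_left_mono) auto
  then show "(1 + \<eta>) * real v < real w"
    using ab by (simp add: mult_ac)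
  have "2 * \<eta> * (\<delta> * real b) < 1"
    using corr_ge_of_large[OF ab(3) pos(2,3) \<delta>, of \<eta>] weak' by linarith
  also have "1 \<le> real a" using pos by simp
  finally have "real g * (2 * \<eta> * (\<delta> * real b)) < real g * real a"
    using pos by (intro mult_strict_left_mono) auto
  then show "2 * \<eta> * \<delta> * real w < real v"
    using ab by (simp add: mult_ac)
qed

section \<open>Dominating sets\<close>

lemma exists_independent_dominating_set:
  assumes "finite V" and sym: "\<And>v w. R v w \<Longrightarrow> R w v"
  shows "\<exists>I\<subseteq>V. (\<forall>v\<in>I. \<forall>w\<in>I. v \<noteq> w \<longrightarrow> \<not> R v w) \<and> (\<forall>v\<in>V - I. \<exists>w\<in>I. R v w)"
  using assms(1)
proof induction
  case (insert x V)
  then obtain I where I: "I \<subseteq> V" "\<forall>v\<in>I. \<forall>w\<in>I. v \<noteq> w \<longrightarrow> \<not> R v w" "\<forall>v\<in>V - I. \<exists>w\<in>I. R v w"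
    by auto
  show ?case
  proof (cases "\<exists>w\<in>I. R x w")
    case True
    with I show ?thesis by (intro exI[of _ I]) auto
  next
    case False
    with I sym show ?thesis by (intro exI[of _ "insert x I"]) blast
  qed
qed auto

lemma geometric_growth_of_separated:
  fixes I :: "nat set"
  assumes "finite I" "\<eta> \<ge> 0" "\<And>v w. v \<in> I \<Longrightarrow> w \<in> I \<Longrightarrow> v < w \<Longrightarrow> (1 + \<eta>) * real v \<le> real w" "I \<noteq> {}"
  shows "(1 + \<eta>) ^ (card I - 1) * real (Min I) \<le> real (Max I)"
  using assms(1,3,4)
proof (induction rule: finite_linorder_max_induct)
  case (insert b A)
  show ?case
  proof (cases "A = {}")
    case False
    have A: "Max A \<in> A" "finite A" "b \<notin> A" using insert False by auto
    have min: "Min (insert b A) = Min A"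
      using A False insert.hyps by (simp add: Min_insert min_def) (meson Min_in leD)
    have max: "Max (insert b A) = b"
      using A False insert.hyps by (simp add: Max_insert max_def) (meson Max_in leD)
    have "card A > 0" using A False by (simp add: card_gt_0_iff)
    then have "(1 + \<eta>) ^ (card (insert b A) - 1) = (1 + \<eta>) * (1 + \<eta>) ^ (card A - 1)"
      using A by (simp flip: power_Suc)
    then have "(1 + \<eta>) ^ (card (insert b A) - 1) * real (Min (insert b A))
        = (1 + \<eta>) * ((1 + \<eta>) ^ (card A - 1) * real (Min A))"
      using min by simp
    also have "\<dots> \<le> (1 + \<eta>) * real (Max A)"
      using insert.IH insert.prems False \<open>\<eta> \<ge> 0\<close> by (intro mult_left_mono) auto
    also have "\<dots> \<le> real b"
      using A insert by auto
    finally show ?thesis using max by simp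
  qed simp
qed simp

text \<open>
  The ratio of the largest to the smallest speed is at least \<open>(1 + \<eta>) ^ (card I - 1)\<close> since consecutive
  speeds are separated, and less than \<open>1 / (2 \<eta> \<delta>)\<close> since the extreme speeds themselves are weakly
  correlated. If \<open>I\<close> has at most one element, there is no pair of extreme speeds to compare.
\<close>

lemma weakly_correlated_set_card:
  assumes fin: "finite I" and pos: "\<And>v. v \<in> I \<Longrightarrow> v > 0"
    and \<delta>: "0 < \<delta>" "\<delta> \<le> 1/2" and \<eta>: "0 < \<eta>"
    and weak: "\<And>v w. v \<in> I \<Longrightarrow> w \<in> I \<Longrightarrow> v \<noteq> w \<Longrightarrow> corr \<delta> v w < (1 - \<eta>) * (4 * \<delta>\<^sup>2)"
  shows "card I \<le> 1 \<or> 2 * \<eta> * \<delta> * (1 + \<eta>) ^ (card I - 1) < 1"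
proof (rule disjCI)
  assume "\<not> 2 * \<eta> * \<delta> * (1 + \<eta>) ^ (card I - 1) < 1"
  show "card I \<le> 1"
  proof (rule ccontr)
    assume c: "\<not> card I \<le> 1"
    then have ne: "I \<noteq> {}" by auto
    have "Min I \<noteq> Max I"
    proof
      assume "Min I = Max I"
      then have "I \<subseteq> {Min I}" using fin by (metis Max_ge Min_le antisym insertI1 subsetI)
      then have "card I \<le> card {Min I}" by (intro card_mono) auto
      then show False using c by simp
    qed
    moreover have mem: "Min I \<in> I" "Max I \<in> I" using fin ne by auto
    ultimately have lt: "Min I < Max I" using fin by (simp add: order_less_le)
    have "(1 + \<eta>) ^ (card I - 1) * real (Min I) \<le> real (Max I)"
      using fin \<eta> ne
      by (intro geometric_growth_of_separated less_imp_le weakly_correlated_ratio(1)[OF _ _ \<delta> \<eta>] weak pos) auto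
    then have "2 * \<eta> * \<delta> * ((1 + \<eta>) ^ (card I - 1) * real (Min I)) \<le> 2 * \<eta> * \<delta> * real (Max I)"
      using \<eta> \<delta> by (intro mult_left_mono) auto
    also have "\<dots> < real (Min I)"
      using mem lt by (intro weakly_correlated_ratio(2)[OF _ _ \<delta> \<eta>] weak pos) auto
    finally have "(2 * \<eta> * \<delta> * (1 + \<eta>) ^ (card I - 1)) * real (Min I) < 1 * real (Min I)"
      by (simp add: mult_ac)
    then show False
      using \<open>\<not> _ < 1\<close> pos[OF mem(1)] by simp
  qed
qed

section \<open>The union bound over a star forest\<close>

text \<open>
  A version of Hunter's inequality for the forest with edges \<open>v -- p v\<close>: each of its components is a
  star centred in \<open>I\<close>. At every covered time, the number of close runners exceeds the number of edges
  with both ends close by at least one: if a centre is close, it is counted and no edge outweighs its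
  leaf; if no centre is close, no edge contributes at all.
\<close>

lemma cover_bound:
  assumes V: "finite V" "I \<subseteq> V" "\<And>v. v \<in> V \<Longrightarrow> v > 0" and \<delta>: "0 < \<delta>" "\<delta> \<le> 1/2"
    and p: "\<And>v. v \<in> V - I \<Longrightarrow> p v \<in> I \<and> c \<le> corr \<delta> v (p v)"
    and cover: "\<And>t. 0 < t \<Longrightarrow> t < 1 \<Longrightarrow> \<exists>v\<in>V. dist_int (t * real v) < \<delta>"
  shows "1 \<le> 2 * \<delta> * real (card V) - c * real (card V - card I)"
proof -
  let ?h = "\<lambda>v t. near \<delta> (real v * t)"
  have fin: "finite I" "finite (V - I)" using V finite_subset by auto
  have pointwise: "1 + (\<Sum>v\<in>V - I. ?h v t * ?h (p v) t) \<le> (\<Sum>v\<in>V. ?h v t)" if "0 < t" "t < 1" for t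
  proof -
    have split: "(\<Sum>v\<in>V. ?h v t) = (\<Sum>v\<in>I. ?h v t) + (\<Sum>v\<in>V - I. ?h v t)"
      using V sum.subset_diff[of I V "\<lambda>v. ?h v t"] by simp
    show ?thesis
    proof (cases "\<exists>v\<in>I. ?h v t = 1")
      case True
      then obtain v where v: "v \<in> I" "?h v t = 1" by auto
      have "1 \<le> (\<Sum>v\<in>I. ?h v t)"
        using member_le_sum[of v I "\<lambda>v. ?h v t"] v fin by (simp add: near_nonneg)
      moreover have "(\<Sum>v\<in>V - I. ?h v t * ?h (p v) t) \<le> (\<Sum>v\<in>V - I. ?h v t)"
        by (intro sum_mono mult_left_le near_le_1 near_nonneg)
      ultimately show ?thesis using split by simp
    next
      case False
      then have 0: "?h v t = 0" if "v \<in> I" for v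
        using that by (auto simp: near_def split: if_splits)
      then have "(\<Sum>v\<in>V - I. ?h v t * ?h (p v) t) = 0"
        using p by (intro sum.neutral) auto
      moreover obtain v where v: "v \<in> V" "?h v t = 1"
        using cover[OF \<open>0 < t\<close> \<open>t < 1\<close>] by (auto simp: near_def mult.commute)
      then have "1 \<le> (\<Sum>v\<in>V. ?h v t)"
        using member_le_sum[of v V "\<lambda>v. ?h v t"] V by (simp add: near_nonneg)
      ultimately show ?thesis by simp
    qed
  qed
  have int1: "periodic_bm (\<lambda>t. \<Sum>v\<in>V - I. ?h v t * ?h (p v) t)"
    using fin by (intro periodic_bm_sum periodic_bm_mult periodic_bm_near_dilate)
  have int2: "periodic_bm (\<lambda>t. \<Sum>v\<in>V. ?h v t)"
    using V by (intro periodic_bm_sum periodic_bm_near_dilate)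
  have "1 + mean (\<lambda>t. \<Sum>v\<in>V - I. ?h v t * ?h (p v) t) =
      integral {0..1} (\<lambda>t. 1 + (\<Sum>v\<in>V - I. ?h v t * ?h (p v) t))"
    unfolding mean_def
    by (subst Henstock_Kurzweil_Integration.integral_add) (auto intro: periodic_bm_integrable[OF int1])
  also have "\<dots> \<le> mean (\<lambda>t. \<Sum>v\<in>V. ?h v t)"
  proof -
    have "integral {0<..<1} (\<lambda>t. 1 + (\<Sum>v\<in>V - I. ?h v t * ?h (p v) t))
        \<le> integral {0<..<1} (\<lambda>t. \<Sum>v\<in>V. ?h v t)"
      using pointwise
      by (intro integral_le)
        (auto simp: integrable_on_open_interval_real intro!: integrable_add periodic_bm_integrable[OF int1] periodic_bm_integrable[OF int2])
    then show ?thesis by (simp add: mean_def integral_open_interval_real)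
  qed
  also have "\<dots> = (\<Sum>v\<in>V. mean (?h v))"
    using V by (intro mean_sum periodic_bm_near_dilate)
  also have "\<dots> = (\<Sum>v\<in>V. 2 * \<delta>)"
    using V \<delta> by (intro sum.cong mean_near_dilate) auto
  finally have "1 + mean (\<lambda>t. \<Sum>v\<in>V - I. ?h v t * ?h (p v) t) \<le> 2 * \<delta> * real (card V)"
    by (simp add: mult.commute)
  moreover have "c * real (card V - card I) \<le> mean (\<lambda>t. \<Sum>v\<in>V - I. ?h v t * ?h (p v) t)"
  proof -
    have "c * real (card V - card I) = (\<Sum>v\<in>V - I. c)"
      using V fin by (simp add: card_Diff_subset)
    also have "\<dots> \<le> (\<Sum>v\<in>V - I. corr \<delta> v (p v))"
      using p by (intro sum_mono) auto
    also have "\<dots> = mean (\<lambda>t. \<Sum>v\<in>V - I. ?h v t * ?h (p v) t)"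
      unfolding corr_def using fin
      by (intro mean_sum[symmetric] periodic_bm_mult periodic_bm_near_dilate)
    finally show ?thesis .
  qed
  ultimately show ?thesis by linarith
qed

section \<open>The gap of loneliness\<close>

lemma eventually_exponential_beats_linear:
  assumes "0 < \<eta>"
  shows "\<forall>\<^sub>F n in sequentially. real n / \<eta> < (1 + \<eta>) powr (\<eta> * real n - 1)"
  using assms by real_asymp

text \<open>
  With \<open>\<eta> = \<epsilon> / 8\<close>, at most \<open>\<eta> n\<close> runners stay without a partner and each overlap loses at most a factor
  \<open>1 - \<eta>\<close>; together this costs a factor \<open>(1 - \<eta>)\<^sup>2 \<ge> 1 - \<epsilon> / 4\<close>. If there were no lonely time, then
  \<open>1 \<le> 2 \<delta> n - (4 - \<epsilon>) \<delta>\<^sup>2 n\<close>. Multiplied by \<open>1 / \<delta>\<^sup>2\<close>, this is the impossible inequality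
  \<open>\<epsilon> n + (2 - \<epsilon>)\<^sup>2 \<le> 0\<close>.
\<close>

lemma lonely_time_of_many_runners:
  assumes \<epsilon>: "0 < \<epsilon>" "\<epsilon> \<le> 1" and n: "n \<ge> 2"
    and V: "finite V" "card V = n" "\<And>v. v \<in> V \<Longrightarrow> v > 0"
    and \<eta>: "\<eta> = \<epsilon> / 8" and \<eta>n: "1 \<le> \<eta> * real n"
    and grow: "real n / \<eta> < (1 + \<eta>) powr (\<eta> * real n - 1)"
  shows "\<exists>t. 0 < t \<and> t < 1 \<and> (\<forall>v\<in>V. 1 / (2 * real n - 2 + \<epsilon>) \<le> dist_int (t * real v))"
proof (rule ccontr)
  assume none: "\<not> ?thesis"
  define \<delta> where "\<delta> = 1 / (2 * real n - 2 + \<epsilon>)"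
  define c where "c = (1 - \<eta>) * (4 * \<delta>\<^sup>2)"
  have D: "2 * real n - 2 + \<epsilon> \<ge> 2" using n \<epsilon> by simp
  have \<delta>: "0 < \<delta>" "\<delta> \<le> 1/2" unfolding \<delta>_def using D by (auto simp: field_simps)
  have \<eta>0: "0 < \<eta>" "\<eta> < 1" using \<eta> \<epsilon> by auto
  have cover: "\<exists>v\<in>V. dist_int (t * real v) < \<delta>" if "0 < t" "t < 1" for t
    using none that by (auto simp: \<delta>_def not_le)
  obtain I where I: "I \<subseteq> V" "\<And>v w. v \<in> I \<Longrightarrow> w \<in> I \<Longrightarrow> v \<noteq> w \<Longrightarrow> \<not> c \<le> corr \<delta> v w"
      "\<And>v. v \<in> V - I \<Longrightarrow> \<exists>w\<in>I. c \<le> corr \<delta> v w"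
    using exists_independent_dominating_set[OF V(1), of "\<lambda>v w. c \<le> corr \<delta> v w"] corr_commute
    by metis
  then obtain p where p: "\<And>v. v \<in> V - I \<Longrightarrow> p v \<in> I \<and> c \<le> corr \<delta> v (p v)"
    by metis
  have card_I: "real (card I) \<le> \<eta> * real n"
  proof (rule ccontr)
    assume *: "\<not> ?thesis"
    then have "card I > 1" using \<eta>n by (metis linorder_not_le of_nat_1 of_nat_le_iff order_trans)
    moreover have "card I \<le> 1 \<or> 2 * \<eta> * \<delta> * (1 + \<eta>) ^ (card I - 1) < 1"
      using I(1) V by (intro weakly_correlated_set_card \<delta> \<eta>0)
        (use I(2) in \<open>auto simp: c_def not_le intro: finite_subset\<close>)
    ultimately have "2 * \<eta> * \<delta> * (1 + \<eta>) ^ (card I - 1) < 1" by simp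
    then have "2 * \<eta> * (1 + \<eta>) ^ (card I - 1) < 2 * real n - 2 + \<epsilon>"
      using D by (simp add: \<delta>_def field_simps)
    also have "\<dots> \<le> 2 * real n" using \<epsilon> by simp
    finally have "(1 + \<eta>) ^ (card I - 1) < real n / \<eta>"
      using \<eta>0 by (simp add: field_simps)
    also have "\<dots> < (1 + \<eta>) powr (\<eta> * real n - 1)" by (rule grow)
    also have "\<dots> \<le> (1 + \<eta>) powr (real (card I - 1))"
      using * \<open>card I > 1\<close> \<eta>0 by (intro powr_mono) (auto simp: of_nat_diff)
    also have "\<dots> = (1 + \<eta>) ^ (card I - 1)"
      using \<eta>0 by (simp add: powr_realpow)
    finally show False by simp
  qed
  have "1 \<le> 2 * \<delta> * real (card V) - c * real (card V - card I)"
    using I(1) V \<delta> p cover by (intro cover_bound) auto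
  also have "\<dots> \<le> 2 * \<delta> * real n - c * ((1 - \<eta>) * real n)"
  proof -
    have "card I \<le> n" using V I(1) card_mono by blast
    then have "(1 - \<eta>) * real n \<le> real (card V - card I)"
      using card_I V by (simp add: of_nat_diff algebra_simps)
    then have "c * ((1 - \<eta>) * real n) \<le> c * real (card V - card I)"
      using \<eta>0 by (intro mult_left_mono) (auto simp: c_def)
    then show ?thesis using V by simp
  qed
  also have "\<dots> \<le> 2 * \<delta> * real n - (4 - \<epsilon>) * \<delta>\<^sup>2 * real n"
  proof -
    have "4 - \<epsilon> \<le> 4 * ((1 - \<eta>) * (1 - \<eta>))"
      using \<eta> by (simp add: algebra_simps)
    then have "(4 - \<epsilon>) * (\<delta>\<^sup>2 * real n) \<le> 4 * ((1 - \<eta>) * (1 - \<eta>)) * (\<delta>\<^sup>2 * real n)"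
      by (intro mult_right_mono) auto
    moreover have "c * ((1 - \<eta>) * real n) = 4 * ((1 - \<eta>) * (1 - \<eta>)) * (\<delta>\<^sup>2 * real n)"
      unfolding c_def by (simp only: mult_ac)
    ultimately have "(4 - \<epsilon>) * (\<delta>\<^sup>2 * real n) \<le> c * ((1 - \<eta>) * real n)"
      by (simp only:)
    then show ?thesis by (simp add: mult.assoc)
  qed
  finally have "(2 * real n - 2 + \<epsilon>)\<^sup>2 \<le> (2 * real n - 2 + \<epsilon>)\<^sup>2 * (2 * \<delta> * real n - (4 - \<epsilon>) * \<delta>\<^sup>2 * real n)"
    by (simp add: mult_le_cancel_left1)
  also have "\<dots> = 2 * real n * (2 * real n - 2 + \<epsilon>) - (4 - \<epsilon>) * real n"
  proof -
    have "d\<^sup>2 * (2 * \<delta> * real n - (4 - \<epsilon>) * \<delta>\<^sup>2 * real n) =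
        2 * real n * d * (d * \<delta>) - (4 - \<epsilon>) * real n * (d * \<delta>)\<^sup>2" for d :: real
      by (simp add: power2_eq_square algebra_simps)
    moreover have "(2 * real n - 2 + \<epsilon>) * \<delta> = 1"
      using D by (simp add: \<delta>_def)
    ultimately show ?thesis by simp
  qed
  finally have "\<epsilon> * real n + (2 - \<epsilon>)\<^sup>2 \<le> 0"
    by (simp add: power2_eq_square algebra_simps)
  moreover have "\<epsilon> * real n > 0" using \<epsilon> n by simp
  ultimately show False using zero_le_power2[of "2 - \<epsilon>"] by linarith
qed

theorem theorem3:
  "\<forall>\<epsilon>::real. \<epsilon> > 0 \<longrightarrow>
    (\<exists>n\<^sub>0::nat. \<forall>n\<ge>n\<^sub>0. \<forall>V::nat set.
      finite V \<and> card V = n \<and> (\<forall>v\<in>V. v > 0) \<longrightarrow>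
      (\<exists>t::real. 0 < t \<and> t < 1 \<and>
        (\<forall>v\<in>V. dist_int (t * real v) \<ge> 1 / (2 * real n - 2 + \<epsilon>))))"
proof (intro allI impI)
  fix \<epsilon> :: real assume \<epsilon>: "\<epsilon> > 0"
  \<comment> \<open>A smaller \<open>\<epsilon>\<close> gives a stronger claim, so it may be assumed to be at most \<open>1\<close>.\<close>
  define \<epsilon>' where "\<epsilon>' = min \<epsilon> 1"
  define \<eta> where "\<eta> = \<epsilon>' / 8"
  have \<epsilon>': "0 < \<epsilon>'" "\<epsilon>' \<le> 1" "\<epsilon>' \<le> \<epsilon>" using \<epsilon> by (auto simp: \<epsilon>'_def)
  then have \<eta>: "0 < \<eta>" by (simp add: \<eta>_def)
  have "\<forall>\<^sub>F n in sequentially. 1 \<le> \<eta> * real n" using \<eta> by real_asymp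
  with eventually_exponential_beats_linear[OF \<eta>] eventually_ge_at_top[of 2]
  have "\<forall>\<^sub>F n in sequentially. n \<ge> 2 \<and> 1 \<le> \<eta> * real n \<and>
      real n / \<eta> < (1 + \<eta>) powr (\<eta> * real n - 1)"
    by eventually_elim simp
  then obtain n\<^sub>0 where n0: "\<And>n. n \<ge> n\<^sub>0 \<Longrightarrow> n \<ge> 2 \<and> 1 \<le> \<eta> * real n \<and>
      real n / \<eta> < (1 + \<eta>) powr (\<eta> * real n - 1)"
    unfolding eventually_sequentially by blast
  show "\<exists>n\<^sub>0::nat. \<forall>n\<ge>n\<^sub>0. \<forall>V::nat set.
      finite V \<and> card V = n \<and> (\<forall>v\<in>V. v > 0) \<longrightarrow>
      (\<exists>t::real. 0 < t \<and> t < 1 \<and>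
        (\<forall>v\<in>V. dist_int (t * real v) \<ge> 1 / (2 * real n - 2 + \<epsilon>)))"
  proof (intro exI[of _ n\<^sub>0] allI impI)
    fix n :: nat and V :: "nat set"
    assume n: "n\<^sub>0 \<le> n" and V: "finite V \<and> card V = n \<and> (\<forall>v\<in>V. v > 0)"
    obtain t where t: "0 < t" "t < 1"
        "\<And>v. v \<in> V \<Longrightarrow> 1 / (2 * real n - 2 + \<epsilon>') \<le> dist_int (t * real v)"
      using lonely_time_of_many_runners[OF \<epsilon>'(1,2) _ _ _ _ \<eta>_def, of n V] n0[OF n] V by blast
    have "1 / (2 * real n - 2 + \<epsilon>) \<le> 1 / (2 * real n - 2 + \<epsilon>')"
      using \<epsilon>' n0[OF n] by (intro divide_left_mono) auto
    then show "\<exists>t::real. 0 < t \<and> t < 1 \<and>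
        (\<forall>v\<in>V. dist_int (t * real v) \<ge> 1 / (2 * real n - 2 + \<epsilon>))"
      using t order_trans by blast
  qed
qed

end
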